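(* Let $\mathbf{A}$ be an integrally closed residuated lattice, and let $\alpha\colon A\to A$ be the map $\alpha(a)=(a\backslash \mathrm{e})\backslash\mathrm{e}$. (a) The map $\alpha\colon \mathbf{A}\to\mathbf{A}_{\sim\sim}$ is a surjective homomorphism (of residuated lattices). (b) $\mathbf{A}_{\sim\sim}$ is an $\ell$-group.
   Context: A residuated lattice is an algebra $\mathbf{A}=\langle A,\wedge,\vee,\cdot,\backslash,/,\mathrm{e}\rangle$ such that $\langle A,\wedge,\vee\rangle$ is a lattice, $\langle A,\cdot,\mathrm{e}\rangle$ is a monoid, and for all $a,b,c\in A$: $b\le a\backslash c \iff ab\le c\iff a\le c/b$. It is integrally closed if it satisfies the quasiequations $xy\le x\Rightarrow y\le \mathrm{e}$ and $yx\le x\Rightarrow y\le\mathrm{e}$, or equivalently, the equations $x\backslash x\approx\mathrm{e}$ and $x/x\approx\mathrm{e}$. In every integrally closed residuated lattice $a\backslash\mathrm{e}=\mathrm{e}/a$ for all $a$; write $\sim a$ for this common value, so $\alpha(a)=\sim\sim a$. The map $\alpha$ is a nucleus on $\langle A,\le,\cdot,\mathrm{e}\rangle$ (increasing, order-preserving, idempotent, and $\alpha(a)\alpha(b)\le\alpha(ab)$), and $\mathbf{A}_{\sim\sim}=\langle\alpha[A],\wedge,\vee_{\sim\sim},\cdot_{\sim\sim},\backslash,/,\mathrm{e}\rangle$, where $a\vee_{\sim\sim}b:=\alpha(a\vee b)$, $a\cdot_{\sim\sim}b:=\alpha(a\cdot b)$, and $\wedge,\backslash,/,\mathrm{e}$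 are those of $\mathbf{A}$ restricted to $\alpha[A]$, is a residuated lattice. An $\ell$-group (lattice-ordered group) is identified with a residuated lattice satisfying $x(x\backslash\mathrm{e})\approx\mathrm{e}$ (with $a^{-1}=a\backslash\mathrm{e}$, $a\backslash b=a^{-1}b$, $b/a=ba^{-1}$). *)

theory Defs
  imports "HOL-Algebra.Group"
begin

no_notation Lattice.meet (infixl "\<sqinter>\<index>" 70)
no_notation Lattice.join (infixl "\<squnion>\<index>" 65)

record 'a residuated_structure = "'a monoid" +
  rl_meet :: "'a \<Rightarrow> 'a \<Rightarrow> 'a" (infixl "\<sqinter>\<index>" 70)
  rl_join :: "'a \<Rightarrow> 'a \<Rightarrow> 'a" (infixl "\<squnion>\<index>" 65)
  lres :: "'a \<Rightarrow> 'a \<Rightarrow> 'a" (infixr "\<setminus>\<index>" 65)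
  rres :: "'a \<Rightarrow> 'a \<Rightarrow> 'a" (infixl "\<sslash>\<index>" 65)

definition rl_le :: "('a, 'm) residuated_structure_scheme \<Rightarrow> 'a \<Rightarrow> 'a \<Rightarrow> bool"
    (infix "\<preceq>\<index>" 50)
  where "x \<preceq>\<^bsub>A\<^esub> y \<longleftrightarrow> x \<sqinter>\<^bsub>A\<^esub> y = x"

locale residuated_lattice = monoid A for A (structure) +
  assumes meet_closed [intro, simp]:
      "\<lbrakk>x \<in> carrier A; y \<in> carrier A\<rbrakk> \<Longrightarrow> x \<sqinter> y \<in> carrier A"
    and join_closed [intro, simp]:
      "\<lbrakk>x \<in> carrier A; y \<in> carrier A\<rbrakk> \<Longrightarrow> x \<squnion> y \<in> carrier A"
    and lres_closed [intro, simp]: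
      "\<lbrakk>x \<in> carrier A; y \<in> carrier A\<rbrakk> \<Longrightarrow> x \<setminus> y \<in> carrier A"
    and rres_closed [intro, simp]:
      "\<lbrakk>x \<in> carrier A; y \<in> carrier A\<rbrakk> \<Longrightarrow> x \<sslash> y \<in> carrier A"
    and meet_comm: "\<lbrakk>x \<in> carrier A; y \<in> carrier A\<rbrakk> \<Longrightarrow> x \<sqinter> y = y \<sqinter> x"
    and join_comm: "\<lbrakk>x \<in> carrier A; y \<in> carrier A\<rbrakk> \<Longrightarrow> x \<squnion> y = y \<squnion> x"
    and meet_assoc: "\<lbrakk>x \<in> carrier A; y \<in> carrier A; z \<in> carrier A\<rbrakk>
      \<Longrightarrow> (x \<sqinter> y) \<sqinter> z = x \<sqinter> (y \<sqinter> z)"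
    and join_assoc: "\<lbrakk>x \<in> carrier A; y \<in> carrier A; z \<in> carrier A\<rbrakk>
      \<Longrightarrow> (x \<squnion> y) \<squnion> z = x \<squnion> (y \<squnion> z)"
    and meet_join_absorb: "\<lbrakk>x \<in> carrier A; y \<in> carrier A\<rbrakk> \<Longrightarrow> x \<sqinter> (x \<squnion> y) = x"
    and join_meet_absorb: "\<lbrakk>x \<in> carrier A; y \<in> carrier A\<rbrakk> \<Longrightarrow> x \<squnion> (x \<sqinter> y) = x"
    and lres_iff: "\<lbrakk>a \<in> carrier A; b \<in> carrier A; c \<in> carrier A\<rbrakk>
      \<Longrightarrow> b \<preceq> a \<setminus> c \<longleftrightarrow> a \<otimes> b \<preceq> c"
    and rres_iff: "\<lbrakk>a \<in> carrier A; b \<in> carrier A; c \<in> carrier A\<rbrakk>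
      \<Longrightarrow> a \<preceq> c \<sslash> b \<longleftrightarrow> a \<otimes> b \<preceq> c"

locale integrally_closed_residuated_lattice = residuated_lattice +
  assumes right_closed:
      "\<lbrakk>x \<in> carrier A; y \<in> carrier A; x \<otimes> y \<preceq> x\<rbrakk> \<Longrightarrow> y \<preceq> \<one>"
    and left_closed:
      "\<lbrakk>x \<in> carrier A; y \<in> carrier A; y \<otimes> x \<preceq> x\<rbrakk> \<Longrightarrow> y \<preceq> \<one>"

text \<open>An \<open>\<ell>\<close>-group in the signature of residuated lattices, with \<open>x \<setminus> \<one>\<close> as the inverse of \<open>x\<close>;
  see \<open>l_group_is_group\<close>, \<open>inv_eq_lres_one\<close>, \<open>lres_eq\<close> and \<open>rres_eq\<close> below for the passage
  to groups.\<close>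

locale l_group = residuated_lattice +
  assumes mult_lres_one: "x \<in> carrier A \<Longrightarrow> x \<otimes> (x \<setminus> \<one>) = \<one>"

definition rl_hom :: "('a, 'm) residuated_structure_scheme \<Rightarrow>
    ('b, 'n) residuated_structure_scheme \<Rightarrow> ('a \<Rightarrow> 'b) set"
  where "rl_hom A B = {h \<in> hom A B.
    h \<one>\<^bsub>A\<^esub> = \<one>\<^bsub>B\<^esub> \<and>
    (\<forall>x \<in> carrier A. \<forall>y \<in> carrier A.
      h (x \<sqinter>\<^bsub>A\<^esub> y) = h x \<sqinter>\<^bsub>B\<^esub> h y \<and>
      h (x \<squnion>\<^bsub>A\<^esub> y) = h x \<squnion>\<^bsub>B\<^esub> h y \<and>
      h (x \<setminus>\<^bsub>A\<^esub> y) = h x \<setminus>\<^bsub>B\<^esub> h y \<and>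
      h (x \<sslash>\<^bsub>A\<^esub> y) = h x \<sslash>\<^bsub>B\<^esub> h y)}"

definition double_neg :: "('a, 'm) residuated_structure_scheme \<Rightarrow> 'a \<Rightarrow> 'a"
  where "double_neg A a = (a \<setminus>\<^bsub>A\<^esub> \<one>\<^bsub>A\<^esub>) \<setminus>\<^bsub>A\<^esub> \<one>\<^bsub>A\<^esub>"

definition double_neg_algebra ::
    "('a, 'm) residuated_structure_scheme \<Rightarrow> 'a residuated_structure"
  where "double_neg_algebra A =
    \<lparr>carrier = double_neg A ` carrier A,
     mult = (\<lambda>a b. double_neg A (a \<otimes>\<^bsub>A\<^esub> b)),
     one = \<one>\<^bsub>A\<^esub>,
     rl_meet = (\<lambda>a b. a \<sqinter>\<^bsub>A\<^esub> b),
     rl_join = (\<lambda>a b. double_neg A (a \<squnion>\<^bsub>A\<^esub> b)),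
     lres = (\<lambda>a b. a \<setminus>\<^bsub>A\<^esub> b),
     rres = (\<lambda>a b. a \<sslash>\<^bsub>A\<^esub> b)\<rparr>"

context residuated_lattice
begin

lemma meet_idem: "x \<in> carrier A \<Longrightarrow> x \<sqinter> x = x"
  by (metis join_meet_absorb meet_join_absorb meet_closed)

lemma le_refl: "x \<in> carrier A \<Longrightarrow> x \<preceq> x"
  by (simp add: rl_le_def meet_idem)

lemma le_antisym: "\<lbrakk>x \<preceq> y; y \<preceq> x; x \<in> carrier A; y \<in> carrier A\<rbrakk> \<Longrightarrow> x = y"
  by (metis rl_le_def meet_comm)

lemma le_trans:
  "\<lbrakk>x \<preceq> y; y \<preceq> z; x \<in> carrier A; y \<in> carrier A; z \<in> carrier A\<rbrakk> \<Longrightarrow> x \<preceq> z"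
  by (metis rl_le_def meet_assoc)

lemma le_iff_join: "\<lbrakk>x \<in> carrier A; y \<in> carrier A\<rbrakk> \<Longrightarrow> x \<preceq> y \<longleftrightarrow> x \<squnion> y = y"
  by (metis rl_le_def join_comm join_meet_absorb meet_comm meet_join_absorb)

abbreviation order_structure :: "'a gorder"
  where "order_structure \<equiv> \<lparr>carrier = carrier A, eq = (=), le = (\<preceq>)\<rparr>"

lemma meet_le1: "\<lbrakk>x \<in> carrier A; y \<in> carrier A\<rbrakk> \<Longrightarrow> x \<sqinter> y \<preceq> x"
  by (simp add: rl_le_def meet_comm [of "x \<sqinter> y" x] meet_assoc [symmetric] meet_idem)

lemma meet_le2: "\<lbrakk>x \<in> carrier A; y \<in> carrier A\<rbrakk> \<Longrightarrow> x \<sqinter> y \<preceq> y"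
  by (simp add: rl_le_def meet_assoc meet_idem)

lemma meet_greatest:
  "\<lbrakk>z \<preceq> x; z \<preceq> y; x \<in> carrier A; y \<in> carrier A; z \<in> carrier A\<rbrakk> \<Longrightarrow> z \<preceq> x \<sqinter> y"
  by (simp add: rl_le_def meet_assoc [symmetric])

lemma le_join1: "\<lbrakk>x \<in> carrier A; y \<in> carrier A\<rbrakk> \<Longrightarrow> x \<preceq> x \<squnion> y"
  by (simp add: rl_le_def meet_join_absorb)

lemma le_join2: "\<lbrakk>x \<in> carrier A; y \<in> carrier A\<rbrakk> \<Longrightarrow> y \<preceq> x \<squnion> y"
  by (simp add: join_comm [of x y] le_join1)

lemma join_least:
  "\<lbrakk>x \<preceq> z; y \<preceq> z; x \<in> carrier A; y \<in> carrier A; z \<in> carrier A\<rbrakk> \<Longrightarrow> x \<squnion> y \<preceq> z"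
  by (simp add: le_iff_join join_assoc)

lemma greatest_meet:
  assumes "x \<in> carrier A" "y \<in> carrier A"
  shows "greatest order_structure (x \<sqinter> y) (Lower order_structure {x, y})"
  using assms by (auto simp: greatest_def Lower_def intro: meet_le1 meet_le2 meet_greatest)

lemma least_join:
  assumes "x \<in> carrier A" "y \<in> carrier A"
  shows "least order_structure (x \<squnion> y) (Upper order_structure {x, y})"
  using assms by (auto simp: least_def Upper_def intro: le_join1 le_join2 join_least)

lemma lattice_order_structure: "Lattice.lattice order_structure"
proof (unfold_locales, goal_cases)
  case (5 x y)
  then have "x = y"
    using le_antisym [of x y] by simp
  then show ?case
    by simp
next
  case (6 x y z)
  then show ?case
    using le_trans [of x y z] by simp
next
  case (9 x y)
  then have "x \<in> carrier A" "y \<in> carrier A"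
    by simp_all
  from least_join [OF this] show ?case
    by blast
next
  case (10 x y)
  then have "x \<in> carrier A" "y \<in> carrier A"
    by simp_all
  from greatest_meet [OF this] show ?case
    by blast
qed (simp_all add: le_refl)

end

context l_group
begin

lemma lres_one_mult:
  assumes x: "x \<in> carrier A"
  shows "(x \<setminus> \<one>) \<otimes> x = \<one>"
proof -
  define y where "y = x \<setminus> \<one>"
  define z where "z = y \<setminus> \<one>"
  have [simp]: "y \<in> carrier A" "z \<in> carrier A"
    using x by (simp_all add: y_def z_def)
  have xy: "x \<otimes> y = \<one>"
    using mult_lres_one [OF x] by (simp add: y_def)
  have yz: "y \<otimes> z = \<one>"
    using mult_lres_one [of y] by (simp add: z_def)
  have "z = (x \<otimes> y) \<otimes> z"
    by (simp add: xy)
  also have "\<dots> = x"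
    using x by (simp add: m_assoc yz)
  finally show ?thesis
    using yz by (simp add: y_def)
qed

lemma l_group_is_group: "group A"
proof (rule group_l_invI)
  show "\<exists>y \<in> carrier A. y \<otimes> x = \<one>" if "x \<in> carrier A" for x
    using lres_one_mult [OF that] that by (intro bexI [of _ "x \<setminus> \<one>"]) simp_all
qed

lemma inv_eq_lres_one: "x \<in> carrier A \<Longrightarrow> inv x = x \<setminus> \<one>"
  by (simp add: group.inv_equality l_group_is_group lres_one_mult)

lemma mult_left_mono:
  assumes "y \<preceq> z" "x \<in> carrier A" "y \<in> carrier A" "z \<in> carrier A"
  shows "x \<otimes> y \<preceq> x \<otimes> z"
proof -
  have "z \<preceq> x \<setminus> (x \<otimes> z)"
    using assms by (simp add: lres_iff le_refl)
  with assms have "y \<preceq> x \<setminus> (x \<otimes> z)"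
    using le_trans [of y z "x \<setminus> (x \<otimes> z)"] by simp
  then show ?thesis
    using assms by (simp add: lres_iff)
qed

lemma mult_right_mono:
  assumes "y \<preceq> z" "x \<in> carrier A" "y \<in> carrier A" "z \<in> carrier A"
  shows "y \<otimes> x \<preceq> z \<otimes> x"
proof -
  have "z \<preceq> (z \<otimes> x) \<sslash> x"
    using assms by (simp add: rres_iff le_refl)
  with assms have "y \<preceq> (z \<otimes> x) \<sslash> x"
    using le_trans [of y z "(z \<otimes> x) \<sslash> x"] by simp
  then show ?thesis
    using assms by (simp add: rres_iff)
qed

lemma lres_eq:
  assumes "a \<in> carrier A" "b \<in> carrier A"
  shows "a \<setminus> b = inv a \<otimes> b"
proof (rule le_antisym)
  interpret group A by (rule l_group_is_group)
  show "inv a \<otimes> b \<preceq> a \<setminus> b"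
    using assms by (simp add: lres_iff le_refl m_assoc [symmetric])
  have "a \<otimes> (a \<setminus> b) \<preceq> b"
    using assms lres_iff [of a "a \<setminus> b" b] by (simp add: le_refl)
  then have "inv a \<otimes> (a \<otimes> (a \<setminus> b)) \<preceq> inv a \<otimes> b"
    using assms by (intro mult_left_mono) auto
  then show "a \<setminus> b \<preceq> inv a \<otimes> b"
    using assms by (simp add: m_assoc [symmetric])
qed (use assms group.inv_closed [OF l_group_is_group] in auto)

lemma rres_eq:
  assumes "a \<in> carrier A" "b \<in> carrier A"
  shows "b \<sslash> a = b \<otimes> inv a"
proof (rule le_antisym)
  interpret group A by (rule l_group_is_group)
  show "b \<otimes> inv a \<preceq> b \<sslash> a"
    using assms by (simp add: rres_iff le_refl m_assoc)
  have "(b \<sslash> a) \<otimes> a \<preceq> b"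
    using assms rres_iff [of "b \<sslash> a" a b] by (simp add: le_refl)
  then have "(b \<sslash> a) \<otimes> a \<otimes> inv a \<preceq> b \<otimes> inv a"
    using assms by (intro mult_right_mono) auto
  then show "b \<sslash> a \<preceq> b \<otimes> inv a"
    using assms by (simp add: m_assoc)
qed (use assms group.inv_closed [OF l_group_is_group] in auto)

end

end

theory Submission
  imports Defs
begin

text \<open>Write \<open>\<sim>x\<close> for \<open>x \<setminus> \<one>\<close> and \<open>\<alpha>\<close> for double negation. Integral closedness makes
  \<open>x \<otimes> y \<preceq> \<one>\<close> symmetric in \<open>x\<close> and \<open>y\<close>, so \<open>\<alpha>\<close> is a nucleus and its image is a residuated
  lattice. That image is an \<open>\<ell>\<close>-group because
  \<open>\<sim>(x \<otimes> \<sim>x) = \<sim>x \<setminus> \<sim>x = \<one>\<close>. A nucleus preserves products and joins; for the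
  residuals and the meet, \<open>\<alpha>\<close> is applied to the inequalities \<open>\<sim>x \<otimes> y \<preceq> x \<setminus> y\<close>,
  \<open>y \<otimes> \<sim>x \<preceq> y \<sslash> x\<close> and \<open>x \<otimes> (\<sim>(x \<squnion> y) \<otimes> y) \<preceq> x \<sqinter> y\<close>, whose two
  sides agree in every \<open>\<ell>\<close>-group.\<close>

section \<open>Monotonicity of multiplication and the basic residuation inequalities\<close>

context residuated_lattice
begin

lemma mult_mono_left:
  assumes "y \<preceq> z" "x \<in> carrier A" "y \<in> carrier A" "z \<in> carrier A"
  shows "x \<otimes> y \<preceq> x \<otimes> z"
proof -
  have "z \<preceq> x \<setminus> (x \<otimes> z)"
    using assms by (simp add: lres_iff le_refl)
  with assms have "y \<preceq> x \<setminus> (x \<otimes> z)"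
    using le_trans [of y z "x \<setminus> (x \<otimes> z)"] by simp
  then show ?thesis
    using assms by (simp add: lres_iff)
qed

lemma mult_mono_right:
  assumes "y \<preceq> z" "x \<in> carrier A" "y \<in> carrier A" "z \<in> carrier A"
  shows "y \<otimes> x \<preceq> z \<otimes> x"
proof -
  have "z \<preceq> (z \<otimes> x) \<sslash> x"
    using assms by (simp add: rres_iff le_refl)
  with assms have "y \<preceq> (z \<otimes> x) \<sslash> x"
    using le_trans [of y z "(z \<otimes> x) \<sslash> x"] by simp
  then show ?thesis
    using assms by (simp add: rres_iff)
qed

lemma mult_le_left:
  assumes "y \<preceq> \<one>" "x \<in> carrier A" "y \<in> carrier A"
  shows "x \<otimes> y \<preceq> x"
  using mult_mono_left [of y \<one> x] assms by simp

lemma mult_le_right: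
  assumes "y \<preceq> \<one>" "x \<in> carrier A" "y \<in> carrier A"
  shows "y \<otimes> x \<preceq> x"
  using mult_mono_right [of y \<one> x] assms by simp

lemma mult_lres_le: "\<lbrakk>x \<in> carrier A; y \<in> carrier A\<rbrakk> \<Longrightarrow> x \<otimes> (x \<setminus> y) \<preceq> y"
  using lres_iff [of x "x \<setminus> y" y] by (simp add: le_refl)

lemma rres_mult_le: "\<lbrakk>x \<in> carrier A; y \<in> carrier A\<rbrakk> \<Longrightarrow> (y \<sslash> x) \<otimes> x \<preceq> y"
  using rres_iff [of "y \<sslash> x" x y] by (simp add: le_refl)

end

section \<open>Half of the formula for meets in an l-group\<close>

context l_group
begin

text \<open>Any lower bound \<open>m\<close> of \<open>p\<close> and \<open>q\<close> has the form
  \<open>p \<otimes> i\<close> with \<open>i \<preceq> \<one>\<close>. Then \<open>p\<close> and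
  \<open>q\<close> both multiply \<open>i\<close> to something below \<open>q\<close>, hence so does
  their join, and this bounds \<open>i\<close>. Writing the inverse as a residual lets the double
  negation algebra's simp rules rewrite an instance in the operations of \<open>A\<close>.\<close>

lemma le_mult_lres_join_mult:
  assumes m: "m \<preceq> p" "m \<preceq> q"
    and c [simp]: "m \<in> carrier A" "p \<in> carrier A" "q \<in> carrier A"
  shows "m \<preceq> p \<otimes> (((p \<squnion> q) \<setminus> \<one>) \<otimes> q)"
proof -
  interpret group A by (rule l_group_is_group)
  define i where "i = inv p \<otimes> m"
  have i [simp]: "i \<in> carrier A"
    by (simp add: i_def)
  have pi: "p \<otimes> i = m"
    by (simp add: i_def m_assoc [symmetric])
  have "i \<preceq> \<one>"
    using mult_left_mono [of m p "inv p"] m by (simp add: i_def)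
  then have "p \<preceq> q \<sslash> i" "q \<preceq> q \<sslash> i"
    using m by (simp_all add: rres_iff pi mult_le_left)
  then have "p \<squnion> q \<preceq> q \<sslash> i"
    by (simp add: join_least)
  then have "(p \<squnion> q) \<otimes> i \<preceq> q"
    by (simp add: rres_iff)
  then have "i \<preceq> inv (p \<squnion> q) \<otimes> q"
    using lres_iff [of "p \<squnion> q" i q] lres_eq [of "p \<squnion> q" q] by simp
  then have "p \<otimes> i \<preceq> p \<otimes> (inv (p \<squnion> q) \<otimes> q)"
    by (intro mult_left_mono) auto
  then show ?thesis
    by (simp add: pi inv_eq_lres_one)
qed

end

text \<open>The order is read off the meet, which is inherited, so inequalities in the image algebra
  can be proved in \<open>A\<close>.\<close>

lemma double_neg_algebra_simps [simp]:
  "carrier (double_neg_algebra A) = double_neg A ` carrier A"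
  "x \<otimes>\<^bsub>double_neg_algebra A\<^esub> y = double_neg A (x \<otimes>\<^bsub>A\<^esub> y)"
  "\<one>\<^bsub>double_neg_algebra A\<^esub> = \<one>\<^bsub>A\<^esub>"
  "x \<sqinter>\<^bsub>double_neg_algebra A\<^esub> y = x \<sqinter>\<^bsub>A\<^esub> y"
  "x \<squnion>\<^bsub>double_neg_algebra A\<^esub> y = double_neg A (x \<squnion>\<^bsub>A\<^esub> y)"
  "x \<setminus>\<^bsub>double_neg_algebra A\<^esub> y = x \<setminus>\<^bsub>A\<^esub> y"
  "x \<sslash>\<^bsub>double_neg_algebra A\<^esub> y = x \<sslash>\<^bsub>A\<^esub> y"
  "x \<preceq>\<^bsub>double_neg_algebra A\<^esub> y \<longleftrightarrow> x \<preceq>\<^bsub>A\<^esub> y"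
  by (simp_all add: double_neg_algebra_def rl_le_def)

section \<open>Negation and double negation under integral closedness\<close>

context integrally_closed_residuated_lattice
begin

abbreviation neg :: "'a \<Rightarrow> 'a" ("\<sim> _" [80] 80)
  where "\<sim> x \<equiv> x \<setminus> \<one>"

abbreviation dneg :: "'a \<Rightarrow> 'a" ("\<alpha>")
  where "\<alpha> \<equiv> double_neg A"

lemma dneg_closed [intro, simp]: "x \<in> carrier A \<Longrightarrow> \<alpha> x \<in> carrier A"
  by (simp add: double_neg_def)

lemma lres_self:
  assumes "x \<in> carrier A"
  shows "x \<setminus> x = \<one>"
  using assms right_closed [of x "x \<setminus> x"]
  by (intro le_antisym) (simp_all add: mult_lres_le lres_iff le_refl)

text \<open>From \<open>y \<otimes> (x \<otimes> y) \<preceq> y\<close>, integral closedness cancels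
  the right-hand \<open>y\<close>.\<close>

lemma mult_le_one_comm:
  assumes "x \<otimes> y \<preceq> \<one>" and [simp]: "x \<in> carrier A" "y \<in> carrier A"
  shows "y \<otimes> x \<preceq> \<one>"
proof (rule left_closed)
  show "(y \<otimes> x) \<otimes> y \<preceq> y"
    using assms by (simp add: m_assoc mult_le_left)
qed simp_all

lemma le_neg_iff: "\<lbrakk>x \<in> carrier A; y \<in> carrier A\<rbrakk> \<Longrightarrow> y \<preceq> \<sim> x \<longleftrightarrow> x \<otimes> y \<preceq> \<one>"
  by (simp add: lres_iff)

text \<open>Together with \<open>le_neg_iff\<close>, this expresses that left and right negation
  coincide, so negation forms a Galois connection with itself.\<close>

lemma le_neg_iff': "\<lbrakk>x \<in> carrier A; y \<in> carrier A\<rbrakk> \<Longrightarrow> y \<preceq> \<sim> x \<longleftrightarrow> y \<otimes> x \<preceq> \<one>"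
  using mult_le_one_comm by (auto simp: lres_iff)

lemma le_dneg_iff: "\<lbrakk>x \<in> carrier A; y \<in> carrier A\<rbrakk> \<Longrightarrow> y \<preceq> \<alpha> x \<longleftrightarrow> \<sim> x \<otimes> y \<preceq> \<one>"
  by (simp add: double_neg_def lres_iff)

lemma neg_mult_le_one: "x \<in> carrier A \<Longrightarrow> \<sim> x \<otimes> x \<preceq> \<one>"
  using le_neg_iff' [of x "\<sim> x"] by (simp add: le_refl)

lemma mult_neg_le_one: "x \<in> carrier A \<Longrightarrow> x \<otimes> \<sim> x \<preceq> \<one>"
  by (simp add: mult_lres_le)

lemma le_dneg: "x \<in> carrier A \<Longrightarrow> x \<preceq> \<alpha> x"
  by (simp add: le_dneg_iff neg_mult_le_one)

lemma neg_antimono: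
  assumes "x \<preceq> y" and [simp]: "x \<in> carrier A" "y \<in> carrier A"
  shows "\<sim> y \<preceq> \<sim> x"
proof -
  have "x \<otimes> \<sim> y \<preceq> y \<otimes> \<sim> y"
    using assms by (intro mult_mono_right) auto
  then show ?thesis
    using le_trans [OF _ mult_neg_le_one [of y]] by (simp add: le_neg_iff)
qed

lemma dneg_mono: "\<lbrakk>x \<preceq> y; x \<in> carrier A; y \<in> carrier A\<rbrakk> \<Longrightarrow> \<alpha> x \<preceq> \<alpha> y"
  by (simp add: double_neg_def neg_antimono)

text \<open>Triple negation collapses as in any antitone Galois connection: negate
  \<open>x \<preceq> \<alpha> x\<close>, and apply \<open>le_dneg\<close> to
  \<open>\<sim> x\<close>.\<close>

lemma neg_dneg: "x \<in> carrier A \<Longrightarrow> \<sim> (\<alpha> x) = \<sim> x"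
  using neg_antimono [OF le_dneg [of x]] le_dneg [of "\<sim> x"]
  by (intro le_antisym) (simp_all add: double_neg_def)

lemma dneg_neg: "x \<in> carrier A \<Longrightarrow> \<alpha> (\<sim> x) = \<sim> x"
  using neg_dneg by (simp add: double_neg_def)

lemma dneg_idem [simp]: "x \<in> carrier A \<Longrightarrow> \<alpha> (\<alpha> x) = \<alpha> x"
  using dneg_neg [of "\<sim> x"] by (simp add: double_neg_def)

lemma dneg_one [simp]: "\<alpha> \<one> = \<one>"
  by (simp add: double_neg_def lres_self)

section \<open>The nucleus property and its consequences for the operations\<close>

lemma dneg_least:
  assumes "x \<preceq> \<alpha> y" "x \<in> carrier A" "y \<in> carrier A"
  shows "\<alpha> x \<preceq> \<alpha> y"
  using dneg_mono [OF assms(1)] assms by simp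

text \<open>A product below \<open>\<one>\<close> may be rotated cyclically, and its leading factor
  may be replaced by its double negation because \<open>neg_dneg\<close> leaves the negation
  unchanged. Doing this for \<open>x\<close> and then \<open>y\<close> in
  \<open>x \<otimes> y \<otimes> n \<preceq> \<one>\<close> gives the claim.\<close>

lemma dneg_mult_le:
  assumes [simp]: "x \<in> carrier A" "y \<in> carrier A"
  shows "\<alpha> x \<otimes> \<alpha> y \<preceq> \<alpha> (x \<otimes> y)"
proof -
  define n where "n = \<sim> (x \<otimes> y)"
  have [simp]: "n \<in> carrier A"
    by (simp add: n_def)
  have "x \<otimes> (y \<otimes> n) \<preceq> \<one>"
    using mult_neg_le_one [of "x \<otimes> y"] by (simp add: n_def m_assoc)
  then have "y \<otimes> n \<preceq> \<sim> (\<alpha> x)"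
    by (simp add: le_neg_iff neg_dneg)
  then have "y \<otimes> (n \<otimes> \<alpha> x) \<preceq> \<one>"
    by (simp add: le_neg_iff' m_assoc)
  then have "n \<otimes> \<alpha> x \<preceq> \<sim> (\<alpha> y)"
    by (simp add: le_neg_iff neg_dneg)
  then have "n \<otimes> (\<alpha> x \<otimes> \<alpha> y) \<preceq> \<one>"
    by (simp add: le_neg_iff' m_assoc)
  then show ?thesis
    by (simp add: le_dneg_iff n_def)
qed

lemma dneg_mult_dneg:
  assumes [simp]: "x \<in> carrier A" "y \<in> carrier A"
  shows "\<alpha> (\<alpha> x \<otimes> \<alpha> y) = \<alpha> (x \<otimes> y)"
proof (rule le_antisym)
  show "\<alpha> (\<alpha> x \<otimes> \<alpha> y) \<preceq> \<alpha> (x \<otimes> y)"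
    by (simp add: dneg_least dneg_mult_le)
  have "x \<otimes> y \<preceq> \<alpha> x \<otimes> y" "\<alpha> x \<otimes> y \<preceq> \<alpha> x \<otimes> \<alpha> y"
    by (simp_all add: mult_mono_left mult_mono_right le_dneg)
  then have "x \<otimes> y \<preceq> \<alpha> x \<otimes> \<alpha> y"
    using le_trans [of "x \<otimes> y" "\<alpha> x \<otimes> y" "\<alpha> x \<otimes> \<alpha> y"] by simp
  then show "\<alpha> (x \<otimes> y) \<preceq> \<alpha> (\<alpha> x \<otimes> \<alpha> y)"
    by (simp add: dneg_mono)
qed simp_all

lemma dneg_mult_dneg1:
  "\<lbrakk>x \<in> carrier A; y \<in> carrier A\<rbrakk> \<Longrightarrow> \<alpha> (\<alpha> x \<otimes> y) = \<alpha> (x \<otimes> y)"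
  using dneg_mult_dneg [of "\<alpha> x" y] dneg_mult_dneg [of x y] by simp

lemma dneg_mult_dneg2:
  "\<lbrakk>x \<in> carrier A; y \<in> carrier A\<rbrakk> \<Longrightarrow> \<alpha> (x \<otimes> \<alpha> y) = \<alpha> (x \<otimes> y)"
  using dneg_mult_dneg [of x "\<alpha> y"] dneg_mult_dneg [of x y] by simp

lemma dneg_join_dneg1:
  assumes [simp]: "x \<in> carrier A" "y \<in> carrier A"
  shows "\<alpha> (\<alpha> x \<squnion> y) = \<alpha> (x \<squnion> y)"
proof (rule le_antisym)
  have "\<alpha> x \<preceq> \<alpha> (x \<squnion> y)"
    by (simp add: dneg_mono le_join1)
  moreover have "y \<preceq> \<alpha> (x \<squnion> y)"
    using le_trans [OF le_join2 [of x y] le_dneg [of "x \<squnion> y"]] by simp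
  ultimately show "\<alpha> (\<alpha> x \<squnion> y) \<preceq> \<alpha> (x \<squnion> y)"
    by (simp add: dneg_least join_least)
  have "x \<preceq> \<alpha> x \<squnion> y"
    using le_trans [OF le_dneg [of x] le_join1 [of "\<alpha> x" y]] by simp
  then show "\<alpha> (x \<squnion> y) \<preceq> \<alpha> (\<alpha> x \<squnion> y)"
    by (intro dneg_mono join_least) (simp_all add: le_join2)
qed simp_all

lemma dneg_join_dneg2:
  "\<lbrakk>x \<in> carrier A; y \<in> carrier A\<rbrakk> \<Longrightarrow> \<alpha> (x \<squnion> \<alpha> y) = \<alpha> (x \<squnion> y)"
  using dneg_join_dneg1 [of y x] by (simp add: join_comm)

lemma dneg_meet_dneg:
  assumes [simp]: "x \<in> carrier A" "y \<in> carrier A"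
  shows "\<alpha> (\<alpha> x \<sqinter> \<alpha> y) = \<alpha> x \<sqinter> \<alpha> y"
proof (rule le_antisym)
  show "\<alpha> (\<alpha> x \<sqinter> \<alpha> y) \<preceq> \<alpha> x \<sqinter> \<alpha> y"
    by (intro meet_greatest dneg_least meet_le1 meet_le2) simp_all
qed (simp_all add: le_dneg)

text \<open>This half of preservation follows from the nucleus property alone; the converse will use
  the group structure of the image.\<close>

lemma dneg_lres_le:
  assumes [simp]: "x \<in> carrier A" "y \<in> carrier A"
  shows "\<alpha> (x \<setminus> y) \<preceq> \<alpha> x \<setminus> \<alpha> y"
  using le_trans [OF dneg_mult_le [of x "x \<setminus> y"] dneg_mono [of "x \<otimes> (x \<setminus> y)" y]]
  by (simp add: lres_iff mult_lres_le)

lemma dneg_rres_le: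
  assumes [simp]: "x \<in> carrier A" "y \<in> carrier A"
  shows "\<alpha> (y \<sslash> x) \<preceq> \<alpha> y \<sslash> \<alpha> x"
  using le_trans [OF dneg_mult_le [of "y \<sslash> x" x] dneg_mono [of "(y \<sslash> x) \<otimes> x" y]]
  by (simp add: rres_iff rres_mult_le)

text \<open>On closed arguments, \<open>dneg_lres_le\<close> and idempotence show that the residual
  is itself closed.\<close>

lemma dneg_lres_dneg:
  assumes [simp]: "x \<in> carrier A" "y \<in> carrier A"
  shows "\<alpha> (\<alpha> x \<setminus> \<alpha> y) = \<alpha> x \<setminus> \<alpha> y"
  using dneg_lres_le [of "\<alpha> x" "\<alpha> y"] by (intro le_antisym) (simp_all add: le_dneg)

lemma dneg_rres_dneg:
  assumes [simp]: "x \<in> carrier A" "y \<in> carrier A"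
  shows "\<alpha> (\<alpha> y \<sslash> \<alpha> x) = \<alpha> y \<sslash> \<alpha> x"
  using dneg_rres_le [of "\<alpha> x" "\<alpha> y"] by (intro le_antisym) (simp_all add: le_dneg)

lemma dneg_mult_neg:
  assumes [simp]: "x \<in> carrier A"
  shows "\<alpha> (x \<otimes> \<sim> x) = \<one>"
proof (rule le_antisym)
  show "\<alpha> (x \<otimes> \<sim> x) \<preceq> \<one>"
    using dneg_mono [OF mult_neg_le_one [of x]] by simp
  \<comment> \<open>Residuate by the two factors in turn: \<open>x\<close> first, then
    \<open>\<sim> x\<close>.\<close>
  have "\<sim> (x \<otimes> \<sim> x) \<preceq> \<sim> x \<setminus> \<sim> x"
    using mult_lres_le [of "x \<otimes> \<sim> x" \<one>] by (simp add: lres_iff m_assoc)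
  then have "\<sim> (x \<otimes> \<sim> x) \<preceq> \<one>"
    by (simp add: lres_self)
  then show "\<one> \<preceq> \<alpha> (x \<otimes> \<sim> x)"
    by (simp add: le_dneg_iff)
qed simp_all

section \<open>The algebra of fixed points of \<alpha>\<close>

lemma mem_dneg_image_iff: "x \<in> \<alpha> ` carrier A \<longleftrightarrow> x \<in> carrier A \<and> \<alpha> x = x"
  by (metis dneg_closed dneg_idem image_iff)

lemma residuated_lattice_double_neg_algebra: "residuated_lattice (double_neg_algebra A)"
proof (unfold_locales, goal_cases)
  case (2 x y z)
  then show ?case
    by (simp add: mem_dneg_image_iff dneg_mult_dneg1 dneg_mult_dneg2 m_assoc)
next
  case (6 x y)
  then show ?case
    using dneg_meet_dneg [of x y] by (simp add: mem_dneg_image_iff)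
next
  case (8 x y)
  then show ?case
    using dneg_lres_dneg [of x y] by (simp add: mem_dneg_image_iff)
next
  case (9 x y)
  then show ?case
    using dneg_rres_dneg [of y x] by (simp add: mem_dneg_image_iff)
next
  case (12 x y z)
  then show ?case
    by (simp add: mem_dneg_image_iff meet_assoc)
next
  case (13 x y z)
  then show ?case
    by (simp add: mem_dneg_image_iff dneg_join_dneg1 dneg_join_dneg2 join_assoc)
next
  case (14 x y)
  then have "x \<preceq> \<alpha> (x \<squnion> y)"
    using le_trans [OF le_join1 [of x y] le_dneg [of "x \<squnion> y"]]
    by (simp add: mem_dneg_image_iff)
  then show ?case
    by (simp add: rl_le_def)
next
  case (16 a b c)
  then show ?case
    \<comment> \<open>Since \<open>c\<close> is closed,
      \<open>\<alpha> (a \<otimes> b) \<preceq> c\<close> is equivalent to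
      \<open>a \<otimes> b \<preceq> c\<close>, so residuation is inherited from
      \<open>A\<close>.\<close>
    using le_trans [of "a \<otimes> b" "\<alpha> (a \<otimes> b)" c] dneg_mono [of "a \<otimes> b" c]
    by (auto simp: mem_dneg_image_iff lres_iff le_dneg)
next
  case (17 a b c)
  then show ?case
    using le_trans [of "a \<otimes> b" "\<alpha> (a \<otimes> b)" c] dneg_mono [of "a \<otimes> b" c]
    by (auto simp: mem_dneg_image_iff rres_iff le_dneg)
qed (auto simp: mem_dneg_image_iff meet_comm join_comm join_meet_absorb)

lemma l_group_double_neg_algebra: "l_group (double_neg_algebra A)"
proof -
  interpret B: residuated_lattice "double_neg_algebra A"
    by (rule residuated_lattice_double_neg_algebra)
  show ?thesis
    by unfold_locales (auto simp: mem_dneg_image_iff dneg_mult_neg)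
qed

section \<open>Preservation of residuals and meets\<close>

lemma dneg_rl_hom: "\<alpha> \<in> rl_hom A (double_neg_algebra A)"
proof -
  interpret B: l_group "double_neg_algebra A"
    by (rule l_group_double_neg_algebra)
  have lres: "\<alpha> (x \<setminus> y) = \<alpha> x \<setminus> \<alpha> y"
    if [simp]: "x \<in> carrier A" "y \<in> carrier A" for x y
  proof (rule le_antisym)
    have "\<sim> x \<otimes> y \<preceq> x \<setminus> y"
      by (simp add: lres_iff m_assoc [symmetric] mult_le_right mult_neg_le_one)
    then have "\<alpha> (\<sim> x \<otimes> y) \<preceq> \<alpha> (x \<setminus> y)"
      by (simp add: dneg_mono)
    \<comment> \<open>In the image l-group the residual is inverse times argument; the inner double
      negations are then absorbed.\<close>
    moreover have "\<alpha> x \<setminus> \<alpha> y = \<alpha> (\<sim> x \<otimes> y)"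
      using B.lres_eq [of "\<alpha> x" "\<alpha> y"] B.inv_eq_lres_one [of "\<alpha> x"]
      by (simp add: neg_dneg dneg_mult_dneg2)
    ultimately show "\<alpha> x \<setminus> \<alpha> y \<preceq> \<alpha> (x \<setminus> y)"
      by simp
  qed (simp_all add: dneg_lres_le)
  have rres: "\<alpha> (x \<sslash> y) = \<alpha> x \<sslash> \<alpha> y"
    if [simp]: "x \<in> carrier A" "y \<in> carrier A" for x y
  proof (rule le_antisym)
    have "x \<otimes> \<sim> y \<preceq> x \<sslash> y"
      by (simp add: rres_iff m_assoc mult_le_left neg_mult_le_one)
    then have "\<alpha> (x \<otimes> \<sim> y) \<preceq> \<alpha> (x \<sslash> y)"
      by (simp add: dneg_mono)
    moreover have "\<alpha> x \<sslash> \<alpha> y = \<alpha> (x \<otimes> \<sim> y)"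
      using B.rres_eq [of "\<alpha> y" "\<alpha> x"] B.inv_eq_lres_one [of "\<alpha> y"]
      by (simp add: neg_dneg dneg_mult_dneg1)
    ultimately show "\<alpha> x \<sslash> \<alpha> y \<preceq> \<alpha> (x \<sslash> y)"
      by simp
  qed (simp_all add: dneg_rres_le)
  have meet: "\<alpha> (x \<sqinter> y) = \<alpha> x \<sqinter> \<alpha> y"
    if [simp]: "x \<in> carrier A" "y \<in> carrier A" for x y
  proof (rule le_antisym)
    show "\<alpha> (x \<sqinter> y) \<preceq> \<alpha> x \<sqinter> \<alpha> y"
      by (intro meet_greatest dneg_mono meet_le1 meet_le2) simp_all
    have "\<sim> (x \<squnion> y) \<otimes> y \<preceq> \<one>"
      using neg_antimono [of y "x \<squnion> y"] by (simp add: le_neg_iff' le_join2)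
    then have 1: "x \<otimes> (\<sim> (x \<squnion> y) \<otimes> y) \<preceq> x"
      by (simp add: mult_le_left)
    have "x \<otimes> \<sim> (x \<squnion> y) \<preceq> \<one>"
      using neg_antimono [of x "x \<squnion> y"] by (simp add: le_neg_iff le_join1)
    then have 2: "x \<otimes> (\<sim> (x \<squnion> y) \<otimes> y) \<preceq> y"
      by (simp add: m_assoc [symmetric] mult_le_right)
    have "\<alpha> (x \<otimes> (\<sim> (x \<squnion> y) \<otimes> y)) \<preceq> \<alpha> (x \<sqinter> y)"
      using 1 2 by (simp add: dneg_mono meet_greatest)
    \<comment> \<open>The l-group bound is applied in the image with \<open>m\<close> the meet
      itself; absorption strips the double negations that its join and products introduce.\<close>
    moreover have "\<alpha> x \<sqinter> \<alpha> y \<preceq> \<alpha> (x \<otimes> (\<sim> (x \<squnion> y) \<otimes> y))"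
      using B.le_mult_lres_join_mult [of "\<alpha> x \<sqinter> \<alpha> y" "\<alpha> x" "\<alpha> y"] B.meet_closed [of "\<alpha> x" "\<alpha> y"]
      by (simp add: meet_le1 meet_le2 neg_dneg dneg_join_dneg1 dneg_join_dneg2
          dneg_mult_dneg1 dneg_mult_dneg2)
    ultimately show "\<alpha> x \<sqinter> \<alpha> y \<preceq> \<alpha> (x \<sqinter> y)"
      using le_trans [of "\<alpha> x \<sqinter> \<alpha> y" "\<alpha> (x \<otimes> (\<sim> (x \<squnion> y) \<otimes> y))" "\<alpha> (x \<sqinter> y)"] by simp
  qed simp_all
  show ?thesis
    by (auto simp: rl_hom_def hom_def lres rres meet dneg_mult_dneg dneg_join_dneg1 dneg_join_dneg2)
qed

end

theorem proposition2p5: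
  fixes A :: "('a, 'm) residuated_structure_scheme"
  assumes "integrally_closed_residuated_lattice A"
  shows "(residuated_lattice (double_neg_algebra A) \<and>
      double_neg A \<in> rl_hom A (double_neg_algebra A) \<and>
      double_neg A ` carrier A = carrier (double_neg_algebra A)) \<and>
    l_group (double_neg_algebra A)"
proof -
  interpret integrally_closed_residuated_lattice A
    by (rule assms)
  show ?thesis
    by (simp add: residuated_lattice_double_neg_algebra l_group_double_neg_algebra dneg_rl_hom)
qed

end
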